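(* Let $G$ be a finite, simple, connected bipartite graph on $\nu$ vertices and let $M$ be a perfect matching of $G$. Suppose that for any two vertices $x$ and $y$ lying in different parts of the bipartition of $G$, $d(x)+d(y)\geq \nu/2+2$. Then $G$ has an $M$-alternating Hamilton cycle.
   Context: $d(x)$ is the degree of $x$. A perfect matching $M$ is a set of pairwise non-adjacent edges covering every vertex. An $M$-alternating cycle is a cycle whose edges lie alternately in $M$ and in $E(G)\setminus M$; an $M$-alternating Hamilton cycle is such a cycle through all vertices of $G$. *)

theory Defs
  imports "Graph_Theory.Graph_Theory"
begin

text \<open>
  Finite simple undirected graphs are rendered by the locale \<open>pair_graph\<close>: a finite vertex set
  with a symmetric, irreflexive set of arcs. An undirected edge is the two-element set of end
  vertices of an arc (and of its reversal).
\<close>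

definition edge_of :: "'a \<times> 'a \<Rightarrow> 'a set" where
  "edge_of a = {fst a, snd a}"

definition edges :: "'a pair_pre_digraph \<Rightarrow> 'a set set" where
  "edges G = edge_of ` parcs G"

text \<open>Since arcs occur in both directions, the arcs leaving \<open>x\<close> correspond bijectively
  to the edges incident with \<open>x\<close>.\<close>

abbreviation degree :: "'a pair_pre_digraph \<Rightarrow> 'a \<Rightarrow> nat" where
  "degree G x \<equiv> out_degree (with_proj G) x"

definition bipartition :: "'a pair_pre_digraph \<Rightarrow> 'a set \<Rightarrow> 'a set \<Rightarrow> bool" where
  "bipartition G X Y \<longleftrightarrow>
     X \<union> Y = pverts G \<and> X \<inter> Y = {} \<and>
     (\<forall>(u, v) \<in> parcs G. (u \<in> X \<and> v \<in> Y) \<or> (u \<in> Y \<and> v \<in> X))"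

definition perfect_matching :: "'a pair_pre_digraph \<Rightarrow> 'a set set \<Rightarrow> bool" where
  "perfect_matching G M \<longleftrightarrow>
     M \<subseteq> edges G \<and>
     (\<forall>e \<in> M. \<forall>f \<in> M. e \<noteq> f \<longrightarrow> e \<inter> f = {}) \<and>
     \<Union>M = pverts G"

text \<open>The predicate \<open>cycle\<close> of the digraph library admits the closed walk that runs along an
  edge and straight back; the length bound excludes this, as usual for undirected graphs.\<close>

definition undirected_cycle :: "'a pair_pre_digraph \<Rightarrow> ('a \<times> 'a) list \<Rightarrow> bool" where
  "undirected_cycle G p \<longleftrightarrow> pre_digraph.cycle (with_proj G) p \<and> 3 \<le> length p"

text \<open>Cyclically consecutive edges of \<open>p\<close>, including the last and the first one, are never
  both in \<open>M\<close> and never both outside \<open>M\<close>.\<close>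

definition alternating_cycle ::
  "'a pair_pre_digraph \<Rightarrow> 'a set set \<Rightarrow> ('a \<times> 'a) list \<Rightarrow> bool" where
  "alternating_cycle G M p \<longleftrightarrow>
     undirected_cycle G p \<and>
     (\<forall>i < length p.
        edge_of (p ! i) \<in> M \<longleftrightarrow> edge_of (p ! (Suc i mod length p)) \<notin> M)"

text \<open>Each vertex of a closed walk is the tail of one of its arcs.\<close>

definition alternating_Hamilton_cycle ::
  "'a pair_pre_digraph \<Rightarrow> 'a set set \<Rightarrow> ('a \<times> 'a) list \<Rightarrow> bool" where
  "alternating_Hamilton_cycle G M p \<longleftrightarrow>
     alternating_cycle G M p \<and> fst ` set p = pverts G"

end

theory Submission
  imports Defs
begin

text \<open>
  Contract every matching edge \<open>{x, f x}\<close> to the vertex \<open>x \<in> X\<close> and draw an arc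
  \<open>x \<rightarrow> y\<close> whenever \<open>f x\<close> is adjacent to \<open>y \<noteq> x\<close>. Alternating Hamilton cycles of \<open>G\<close> are
  the Hamilton cycles of this digraph on \<open>n = \<nu>/2\<close> vertices, and the degree condition becomes:
  every out-degree plus every in-degree is at least \<open>n\<close>.

  In such a digraph take a longest cycle \<open>C\<close>, of length \<open>m < n\<close> say, and a longest path
  outside \<open>C\<close>, with \<open>k\<close> vertices, from \<open>u\<close> to \<open>w\<close>. Let \<open>S\<close> be the set of
  in-neighbours of \<open>u\<close> on \<open>C\<close> and \<open>T\<close> the set of out-neighbours of \<open>w\<close> on \<open>C\<close>.
  As the path is longest, \<open>\<bar>S\<bar> + \<bar>T\<bar> \<ge> n - 2(k - 1) \<ge> m - k + 2\<close>. No element of \<open>T\<close> lies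
  within distance \<open>k\<close> after an element of \<open>S\<close> (otherwise the path could be spliced in to lengthen
  \<open>C\<close>), so if both sets are nonempty then \<open>\<bar>S\<bar> + \<bar>T\<bar> \<le> m - k + 1\<close>, a contradiction.
  If \<open>S\<close> is empty, \<open>u\<close> has in-degree at most \<open>k - 1\<close>, so every out-degree is at least \<open>m + 1\<close>,
  which yields a cycle longer than \<open>C\<close>; the case of empty \<open>T\<close> is dual.
\<close>

section \<open>Directed paths and cycles as vertex lists\<close>

definition dipath :: "('a \<Rightarrow> 'a \<Rightarrow> bool) \<Rightarrow> 'a list \<Rightarrow> bool" where
  "dipath R xs \<longleftrightarrow> xs \<noteq> [] \<and> distinct xs \<and> successively R xs"

text \<open>Two vertices joined in both directions count as a cycle: in the contracted digraph they
  stand for a 4-cycle of \<open>G\<close>.\<close>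

definition dicycle :: "('a \<Rightarrow> 'a \<Rightarrow> bool) \<Rightarrow> 'a list \<Rightarrow> bool" where
  "dicycle R xs \<longleftrightarrow> dipath R xs \<and> R (last xs) (hd xs)"

lemma ex_longest:
  fixes P :: "'a list \<Rightarrow> bool"
  assumes "finite V" "P xs" "\<And>xs. P xs \<Longrightarrow> distinct xs \<and> set xs \<subseteq> V"
  obtains ys where "P ys" "\<And>zs. P zs \<Longrightarrow> length zs \<le> length ys"
proof -
  have "length zs < Suc (card V)" if "P zs" for zs
    using assms(3)[OF that] assms(1) by (metis card_mono distinct_card less_Suc_eq_le)
  then show thesis
    using ex_has_greatest_nat[of P xs length "Suc (card V)"] assms(2) that by blast
qed

text \<open>A neighbour off a longest path could be attached at the corresponding end. Only this
  maximality at both ends is passed on.\<close>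

lemma ex_longest_dipath:
  assumes "finite V" "V \<noteq> {}"
  obtains xs where "dipath R xs" "set xs \<subseteq> V"
    "{y \<in> V. R (last xs) y} \<subseteq> set xs" "{y \<in> V. R y (hd xs)} \<subseteq> set xs"
proof -
  obtain v where v: "v \<in> V" using assms(2) by blast
  have "dipath R [v] \<and> set [v] \<subseteq> V" using v by (simp add: dipath_def)
  then obtain xs where xs: "dipath R xs" "set xs \<subseteq> V"
    and mx: "\<And>zs. dipath R zs \<and> set zs \<subseteq> V \<Longrightarrow> length zs \<le> length xs"
    using ex_longest[of V "\<lambda>zs. dipath R zs \<and> set zs \<subseteq> V" "[v]"] assms(1)
    by (metis dipath_def)
  have "y \<in> set xs" if "y \<in> V" "R (last xs) y" for y
    using mx[of "xs @ [y]"] xs that by (auto simp: dipath_def successively_append_iff)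
  moreover have "y \<in> set xs" if "y \<in> V" "R y (hd xs)" for y
    using mx[of "y # xs"] xs that by (auto simp: dipath_def successively_Cons)
  ultimately show thesis using that xs by blast
qed

text \<open>All out-neighbours of the end of a longest path lie on the path. Cutting the path at the
  first of them and closing it up gives a cycle through all of them and the end itself, hence
  through more than \<open>d\<close> vertices.\<close>

lemma ex_dicycle_of_min_outdegree:
  assumes "finite V" "V \<noteq> {}" "\<And>x. x \<in> V \<Longrightarrow> \<not> R x x"
    and "0 < d" "\<And>x. x \<in> V \<Longrightarrow> d \<le> card {y \<in> V. R x y}"
  obtains xs where "dicycle R xs" "set xs \<subseteq> V" "d < length xs"
proof -
  obtain xs where xs: "dipath R xs" "set xs \<subseteq> V" "{y \<in> V. R (last xs) y} \<subseteq> set xs"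
    using ex_longest_dipath assms(1,2) by metis
  have "last xs \<in> V" using xs by (auto simp: dipath_def)
  let ?N = "{y \<in> V. R (last xs) y}"
  have "?N \<noteq> {}" using assms(4) assms(5)[OF \<open>last xs \<in> V\<close>] by (metis card.empty not_le)
  then have "\<exists>y\<in>set xs. R (last xs) y" using xs(3) by blast
  then obtain ys y zs where s: "xs = ys @ y # zs" "R (last xs) y" "\<forall>w\<in>set ys. \<not> R (last xs) w"
    using split_list_first_prop[of xs "R (last xs)"] by blast
  have dp: "dipath R (y # zs)" "last (y # zs) = last xs"
    using xs(1) s(1) by (auto simp: dipath_def successively_append_iff)
  have "?N \<subseteq> set (y # zs) - {last xs}"
    using xs(3) s assms(3)[OF \<open>last xs \<in> V\<close>] by auto
  then have "card ?N \<le> card (set (y # zs) - {last xs})" by (intro card_mono) auto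
  also have "\<dots> < card (set (y # zs))"
    using dp(2) by (metis card_Diff1_less finite_set last_in_set list.distinct(1))
  also have "\<dots> = length (y # zs)" using dp(1) distinct_card dipath_def by blast
  finally have "d < length (y # zs)" using assms(5)[OF \<open>last xs \<in> V\<close>] by linarith
  then show thesis using that[of "y # zs"] dp s xs(2) by (auto simp: dicycle_def)
qed

lemma dicycle_rev: "dicycle R\<inverse>\<inverse> xs \<Longrightarrow> dicycle R (rev xs)"
  by (auto simp: dicycle_def dipath_def successively_rev hd_rev last_rev conversep_iff[abs_def])

lemma ex_dicycle_of_min_indegree:
  assumes "finite V" "V \<noteq> {}" "\<And>x. x \<in> V \<Longrightarrow> \<not> R x x"
    and "0 < d" "\<And>x. x \<in> V \<Longrightarrow> d \<le> card {y \<in> V. R y x}"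
  obtains xs where "dicycle R xs" "set xs \<subseteq> V" "d < length xs"
proof -
  obtain xs where "dicycle R\<inverse>\<inverse> xs" "set xs \<subseteq> V" "d < length xs"
    using ex_dicycle_of_min_outdegree[of V "R\<inverse>\<inverse>" d] assms by auto
  then show thesis using that[of "rev xs"] dicycle_rev by auto
qed

lemma dicycle_rotate1: "dicycle R xs \<Longrightarrow> dicycle R (rotate1 xs)"
  by (cases xs)
    (auto simp: dicycle_def dipath_def successively_append_iff successively_Cons hd_append
      split: if_splits)

lemma dicycle_rotate: "dicycle R xs \<Longrightarrow> dicycle R (rotate k xs)"
  by (induction k) (auto simp: dicycle_rotate1)

section \<open>Sumsets modulo m\<close>

lemma closed_under_cyclic_successor:
  fixes A :: "nat set"
  assumes "a \<in> A" "a < m" "\<And>i. i \<in> A \<Longrightarrow> Suc i mod m \<in> A" "i < m"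
  shows "i \<in> A"
proof -
  have *: "(a + k) mod m \<in> A" for k
  proof (induction k)
    case (Suc k)
    then show ?case using assms(3) by (metis add_Suc_right mod_Suc_eq)
  qed (use assms(1,2) in simp)
  \<comment> \<open>The detour over \<open>m\<close> avoids the truncated difference
    \<open>i - a\<close>.\<close>
  have "(a + (m - a + i)) mod m = i" using assms(2,4) by simp
  then show ?thesis using *[of "m - a + i"] by simp
qed

lemma card_cyclic_sumset:
  fixes S T :: "nat set"
  assumes "S \<subseteq> {..<m}" "T \<subseteq> {..<m}" "S \<noteq> {}" "T \<noteq> {}"
    and "0 < k" "\<And>s j. s \<in> S \<Longrightarrow> 0 < j \<Longrightarrow> j \<le> k \<Longrightarrow> (s + j) mod m \<notin> T"
  shows "card S + card T + k \<le> m + 1"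
proof -
  \<comment> \<open>\<open>A j\<close> grows with every \<open>j\<close> until it is everything, which the nonempty \<open>T\<close> prevents.\<close>
  define A where "A j = {(s + i) mod m |s i. s \<in> S \<and> 0 < i \<and> i \<le> j}" for j
  have m: "0 < m" using assms(1,3) by fastforce
  have Am: "A j \<subseteq> {..<m}" for j using m by (auto simp: A_def)
  then have fin: "finite (A j)" for j using finite_subset by blast
  \<comment> \<open>The count starts at \<open>A 1\<close>, a shifted copy of \<open>S\<close>,
    because \<open>A 0\<close> is empty; hence \<open>k - 1\<close> growth steps up to
    \<open>A k\<close>.\<close>
  have "card S + j \<le> card (A (Suc j))" if "j < k" for j
    using that
  proof (induction j)
    case 0
    have "inj_on (\<lambda>s. Suc s mod m) {..<m}"
      by (auto simp: inj_on_def mod_Suc split: if_splits)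
    then have "inj_on (\<lambda>s. Suc s mod m) S" using assms(1) inj_on_subset by blast
    moreover have "(\<lambda>s. Suc s mod m) ` S \<subseteq> A (Suc 0)" unfolding A_def by force
    ultimately show ?case using card_inj_on_le[OF _ _ fin] by fastforce
  next
    case (Suc j)
    have sub: "A (Suc j) \<subseteq> A (Suc (Suc j))" unfolding A_def using le_SucI by blast
    \<comment> \<open>A set that stopped growing would be closed under successor modulo
      \<open>m\<close>, so it would contain every residue, including one in
      \<open>T\<close>.\<close>
    have "A (Suc j) \<noteq> A (Suc (Suc j))"
    proof
      assume eq: "A (Suc j) = A (Suc (Suc j))"
      have step: "Suc i mod m \<in> A (Suc j)" if i: "i \<in> A (Suc j)" for i
      proof -
        obtain s l where "i = (s + l) mod m" "s \<in> S" "0 < l" "l \<le> Suc j"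
          using i unfolding A_def by blast
        then have "Suc i mod m = (s + Suc l) mod m" "s \<in> S" "0 < Suc l" "Suc l \<le> Suc (Suc j)"
          by (auto simp: mod_Suc_eq)
        then show ?thesis unfolding eq unfolding A_def by blast
      qed
      obtain s where "s \<in> S" using assms(3) by blast
      then have a: "Suc s mod m \<in> A (Suc j)" unfolding A_def by force
      obtain t where t: "t \<in> T" "t < m" using assms(2,4) by blast
      have "t \<in> A (Suc j)"
        using closed_under_cyclic_successor[OF a _ step t(2)] m by simp
      then show False using t(1) assms(6) Suc.prems unfolding A_def by fastforce
    qed
    then have "card (A (Suc j)) < card (A (Suc (Suc j)))"
      using sub fin psubset_card_mono by blast
    then show ?case using Suc by simp
  qed
  from this[of "k - 1"] have "card S + (k - 1) \<le> card (A k)" using assms(5) by simp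
  moreover have "A k \<inter> T = {}" using assms(6) unfolding A_def by blast
  then have "card (A k) + card T = card (A k \<union> T)"
    using fin assms(2) finite_subset by (metis card_Un_disjoint finite_lessThan)
  moreover have "card (A k \<union> T) \<le> m"
    using Am[of k] assms(2) card_mono[of "{..<m}" "A k \<union> T"] by simp
  ultimately show ?thesis using assms(5) by linarith
qed

section \<open>Hamilton cycles under a degree-sum condition\<close>

text \<open>The path replaces the \<open>j - 1\<close> vertices strictly between positions
  \<open>s\<close> and \<open>s + j\<close>. Rotating by \<open>Suc s\<close> puts
  \<open>xs ! s\<close> last, so that these vertices form a prefix to be dropped.\<close>

lemma dicycle_insert_dipath:
  assumes "dicycle R xs" "dipath R ps" "set xs \<inter> set ps = {}"
    and "s < length xs" "0 < j" "j \<le> length xs"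
    and "R (xs ! s) (hd ps)" "R (last ps) (xs ! ((s + j) mod length xs))"
  obtains zs where "dicycle R zs" "set zs \<subseteq> set xs \<union> set ps"
    "length zs + j = length xs + length ps + 1"
proof -
  let ?m = "length xs"
  define ys where "ys = rotate (Suc s) xs"
  have ys: "dicycle R ys" "set ys = set xs" "length ys = ?m"
    using assms(1) dicycle_rotate[of R xs "Suc s"] by (auto simp: ys_def)
  have ne: "ys \<noteq> []" using ys(1) by (auto simp: dicycle_def dipath_def)
  have "last ys = ys ! (?m - 1)" using ne ys(3) by (simp add: last_conv_nth)
  also have "\<dots> = xs ! ((Suc s + (?m - 1)) mod ?m)"
    unfolding ys_def using assms(4) by (subst nth_rotate) auto
  also have "Suc s + (?m - 1) = s + ?m" using assms(4) by simp
  also have "(s + ?m) mod ?m = s" using assms(4) by simp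
  finally have l: "last ys = xs ! s" .
  have h: "ys ! (j - 1) = xs ! ((s + j) mod ?m)"
    unfolding ys_def using assms(4-6) by (subst nth_rotate) auto
  \<comment> \<open>In the extreme case \<open>j = length xs\<close> only \<open>xs ! s\<close>
    survives, and the path leaves from it and returns to it.\<close>
  define ds where "ds = drop (j - 1) ys"
  have ds: "ds \<noteq> []" "hd ds = xs ! ((s + j) mod ?m)" "last ds = xs ! s"
    using assms(4-6) ys(3) h l by (auto simp: ds_def hd_drop_conv_nth)
  have sp: "ys = take (j - 1) ys @ ds" by (simp add: ds_def)
  have "successively R (take (j - 1) ys @ ds)" "distinct (take (j - 1) ys @ ds)"
    using ys(1) sp by (simp_all add: dicycle_def dipath_def)
  then have "successively R ds" "distinct ds" by (auto simp: successively_append_iff)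
  moreover have "set ds \<subseteq> set xs" using ys(2) set_drop_subset unfolding ds_def by fast
  ultimately have "dicycle R (ds @ ps)" "set (ds @ ps) \<subseteq> set xs \<union> set ps"
    using ds assms by (auto simp: dicycle_def dipath_def successively_append_iff)
  moreover have "length (ds @ ps) + j = ?m + length ps + 1"
    using assms(4-6) ys(3) by (simp add: ds_def)
  ultimately show thesis using that by blast
qed

text \<open>A form of Woodall's theorem. The path outside the longest cycle enters only through its
  maximality at both ends.\<close>

lemma Hamilton_dicycle:
  assumes fin: "finite V" and "2 \<le> card V" and irr: "\<And>x. x \<in> V \<Longrightarrow> \<not> R x x"
    and deg: "\<And>x y. x \<in> V \<Longrightarrow> y \<in> V \<Longrightarrow>
      card V \<le> card {z \<in> V. R x z} + card {z \<in> V. R z y}"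
  obtains xs where "dicycle R xs" "set xs = V"
proof -
  let ?out = "\<lambda>x. card {z \<in> V. R x z}" and ?in = "\<lambda>x. card {z \<in> V. R z x}"
  have ne: "V \<noteq> {}" using assms(2) by auto
  have "\<exists>xs. dicycle R xs \<and> set xs \<subseteq> V"
  proof (cases "\<forall>x\<in>V. 1 \<le> ?out x")
    case True
    then show ?thesis using ex_dicycle_of_min_outdegree[of V R 1] fin ne irr by auto
  next
    case False
    \<comment> \<open>A vertex of out-degree 0 forces every in-degree up to
      \<open>card V\<close>.\<close>
    then have "\<forall>y\<in>V. 1 \<le> ?in y" using deg assms(2) by fastforce
    then show ?thesis using ex_dicycle_of_min_indegree[of V R 1] fin ne irr by auto
  qed
  then obtain xs where xs: "dicycle R xs" "set xs \<subseteq> V"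
    and mx: "\<And>zs. dicycle R zs \<Longrightarrow> set zs \<subseteq> V \<Longrightarrow> length zs \<le> length xs"
    using ex_longest[of V "\<lambda>zs. dicycle R zs \<and> set zs \<subseteq> V"] fin
    by (metis dicycle_def dipath_def)
  let ?m = "length xs"
  have dx: "distinct xs" "card (set xs) = ?m" "xs \<noteq> []"
    using xs(1) distinct_card by (auto simp: dicycle_def dipath_def)
  have "set xs = V"
  proof (rule ccontr)
    assume "set xs \<noteq> V"
    then have "V - set xs \<noteq> {}" using xs(2) by blast
    then obtain ps where ps: "dipath R ps" "set ps \<subseteq> V - set xs"
      "{y \<in> V - set xs. R (last ps) y} \<subseteq> set ps" "{y \<in> V - set xs. R y (hd ps)} \<subseteq> set ps"
      using ex_longest_dipath[of "V - set xs" R] fin by blast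
    let ?k = "length ps" and ?u = "hd ps" and ?w = "last ps"
    have k: "card (set ps) = ?k" "0 < ?k" and uw: "?u \<in> set ps" "?w \<in> set ps"
      using ps(1) distinct_card by (auto simp: dipath_def)
    have uwV: "?u \<in> V" "?w \<in> V" using uw ps(2) by auto
    have "card (set xs \<union> set ps) = ?m + ?k" using ps(2) dx(2) k(1) by (subst card_Un_disjoint) auto
    then have mk: "?m + ?k \<le> card V" using card_mono[OF fin, of "set xs \<union> set ps"] xs(2) ps(2) by auto
    \<comment> \<open>Positions instead of vertices, so that distance along the cycle is arithmetic
      modulo \<open>?m\<close>.\<close>
    define S where "S = {i. i < ?m \<and> R (xs ! i) ?u}"
    define T where "T = {i. i < ?m \<and> R ?w (xs ! i)}"
    \<comment> \<open>By maximality, in-neighbours off the cycle lie on \<open>ps\<close>;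
      irreflexivity excludes \<open>?u\<close>, which leaves \<open>?k - 1\<close> of them at
      most.\<close>
    have "{z \<in> V. R z ?u} \<subseteq> (!) xs ` S \<union> (set ps - {?u})"
      using ps(4) irr[OF uwV(1)] by (auto simp: S_def in_set_conv_nth)
    then have "?in ?u \<le> card ((!) xs ` S \<union> (set ps - {?u}))" by (intro card_mono) (auto simp: S_def)
    also have "\<dots> \<le> card ((!) xs ` S) + card (set ps - {?u})" by (rule card_Un_le)
    also have "\<dots> \<le> card S + (?k - 1)"
      using uw k card_image_le[of S] by (simp add: S_def)
    finally have inu: "?in ?u \<le> card S + (?k - 1)" .
    have "{z \<in> V. R ?w z} \<subseteq> (!) xs ` T \<union> (set ps - {?w})"
      using ps(3) irr[OF uwV(2)] by (auto simp: T_def in_set_conv_nth)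
    then have "?out ?w \<le> card ((!) xs ` T \<union> (set ps - {?w}))" by (intro card_mono) (auto simp: T_def)
    also have "\<dots> \<le> card ((!) xs ` T) + card (set ps - {?w})" by (rule card_Un_le)
    also have "\<dots> \<le> card T + (?k - 1)"
      using uw k card_image_le[of T] by (simp add: T_def)
    finally have outw: "?out ?w \<le> card T + (?k - 1)" .
    have "S \<noteq> {}"
    proof
      assume "S = {}"
      then have "?in ?u \<le> ?k - 1" using inu by simp
      then have "Suc ?m \<le> ?out x" if "x \<in> V" for x
        using mk k(2) deg[OF that uwV(1)] by linarith
      then obtain zs where "dicycle R zs" "set zs \<subseteq> V" "Suc ?m < length zs"
        using ex_dicycle_of_min_outdegree[of V R "Suc ?m"] fin ne irr by auto
      then show False using mx[of zs] by simp
    qed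
    have "T \<noteq> {}"
    proof
      assume "T = {}"
      then have "?out ?w \<le> ?k - 1" using outw by simp
      then have "Suc ?m \<le> ?in x" if "x \<in> V" for x
        using mk k(2) deg[OF uwV(2) that] by linarith
      then obtain zs where "dicycle R zs" "set zs \<subseteq> V" "Suc ?m < length zs"
        using ex_dicycle_of_min_indegree[of V R "Suc ?m"] fin ne irr by auto
      then show False using mx[of zs] by simp
    qed
    \<comment> \<open>Splicing gives a cycle of \<open>?m + ?k + 1 - j\<close> vertices, too long
      when \<open>j \<le> ?k\<close>. The cap \<open>?m\<close> keeps \<open>j\<close> within one
      turn of the cycle.\<close>
    have gap: "(s + j) mod ?m \<notin> T" if sj: "s \<in> S" "0 < j" "j \<le> min ?k ?m" for s j
    proof
      assume "(s + j) mod ?m \<in> T"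
      then obtain zs where "dicycle R zs" "set zs \<subseteq> set xs \<union> set ps" "length zs + j = ?m + ?k + 1"
        using dicycle_insert_dipath[OF xs(1) ps(1), of s j] sj ps(2) by (auto simp: S_def T_def)
      then show False using mx[of zs] xs(2) ps(2) sj(3) by auto
    qed
    have "card S + card T + min ?k ?m \<le> ?m + 1"
      using card_cyclic_sumset[of S ?m T "min ?k ?m"] gap \<open>S \<noteq> {}\<close> \<open>T \<noteq> {}\<close> k(2) dx(3)
      by (auto simp: S_def T_def)
    \<comment> \<open>This rules out \<open>?m < ?k\<close>, where the bound would leave at most 1
      for \<open>card S + card T\<close>.\<close>
    moreover have "0 < card S" "0 < card T"
      using \<open>S \<noteq> {}\<close> \<open>T \<noteq> {}\<close> by (auto simp: S_def T_def card_gt_0_iff)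
    ultimately have "card S + card T + ?k \<le> ?m + 1" by linarith
    \<comment> \<open>The degree sum is at most \<open>?m + ?k - 1\<close>, but
      \<open>card V\<close> is at least \<open>?m + ?k\<close>.\<close>
    then show False using deg[OF uwV(2,1)] inu outw mk k(2) by linarith
  qed
  then show thesis using that xs(1) by blast
qed


section \<open>From directed cycles to alternating cycles\<close>

text \<open>Undoes the contraction: each vertex opens up into its matching edge. The relation
  \<open>E\<close> is left general so that it can also record membership in the matching.\<close>

lemma dicycle_expand:
  assumes "dicycle R xs" "inj_on f (set xs)" "f ` set xs \<inter> set xs = {}"
    and "\<And>x. x \<in> set xs \<Longrightarrow> E x (f x)"
    and "\<And>x y. x \<in> set xs \<Longrightarrow> y \<in> set xs \<Longrightarrow> R x y \<Longrightarrow> E (f x) y"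
  shows "dicycle E (concat (map (\<lambda>x. [x, f x]) xs))"
proof -
  let ?g = "\<lambda>xs. concat (map (\<lambda>x. [x, f x]) xs)"
  have hd: "hd (?g ys) = hd ys" if "ys \<noteq> []" for ys using that by (cases ys) auto
  have last: "last (?g ys) = f (last ys)" if "ys \<noteq> []" for ys
    using that by (induction ys) auto
  have xs: "xs \<noteq> []" "distinct xs" "successively R xs" "R (last xs) (hd xs)"
    using assms(1) by (auto simp: dicycle_def dipath_def)
  have "distinct (?g xs)" using xs(2) assms(2,3) by (induction xs) auto
  moreover have "successively E (?g xs)" using xs(3) assms(4,5)
  proof (induction xs rule: induct_list012)
    case (3 x y zs)
    then show ?case by (auto simp: successively_Cons)
  qed auto
  moreover have "E (last (?g xs)) (hd (?g xs))" using hd last xs assms(5) by simp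
  ultimately show ?thesis using xs(1) by (cases xs) (auto simp: dicycle_def dipath_def)
qed

lemma cycle_of_dicycle:
  assumes "pair_wf_digraph G" "dicycle (\<lambda>a b. (a, b) \<in> parcs G) w"
  shows "pre_digraph.cycle (with_proj G) (zip w (rotate1 w))"
proof -
  interpret pair_wf_digraph G by fact
  obtain u us where w: "w = u # us" using assms(2) by (cases w) (auto simp: dicycle_def dipath_def)
  \<comment> \<open>The end \<open>v\<close> is kept apart from the start \<open>a\<close>, as the
    induction moves only the start; the cycle itself is the case \<open>v = a\<close>.\<close>
  have verts: "pawalk_verts a (zip (a # as) (as @ [v])) = a # as @ [v]" for a v and as :: "'a list"
    by (induction as arbitrary: a) auto
  have cas: "pcas a (zip (a # as) (as @ [v])) v" for a v and as :: "'a list"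
    by (induction as arbitrary: a) auto
  have arcs: "set (zip (a # as) (as @ [v])) \<subseteq> parcs G"
    if "successively (\<lambda>a b. (a, b) \<in> parcs G) (a # as @ [v])" for a v and as :: "'a list"
    using that by (induction as arbitrary: a) auto
  have "successively (\<lambda>a b. (a, b) \<in> parcs G) (u # us @ [u])"
    using assms(2) w
    by (auto simp: dicycle_def dipath_def successively_Cons successively_append_iff hd_append)
  from arcs[OF this] have "awalk u (zip w (rotate1 w)) u"
    unfolding awalk_def using cas[of u us u] w in_arcsD1[of u] by (cases us) auto
  moreover have "distinct (tl (pawalk_verts u (zip w (rotate1 w))))"
    using verts[of u us u] assms(2) w by (auto simp: dicycle_def dipath_def)
  ultimately show ?thesis unfolding cycle_def using w by auto
qed

text \<open>The relation directs matching edges from \<open>X\<close> to \<open>Y\<close> and all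
  other edges from \<open>Y\<close> to \<open>X\<close>.\<close>

lemma alternating_Hamilton_cycle_of_dicycle:
  assumes "pair_wf_digraph G" "bipartition G X Y"
    and w: "dicycle (\<lambda>a b. (a, b) \<in> parcs G \<and> ({a, b} \<in> M \<longleftrightarrow> a \<in> X)) w"
    and "set w = pverts G" "3 \<le> length w"
  shows "alternating_Hamilton_cycle G M (zip w (rotate1 w))"
proof -
  let ?p = "zip w (rotate1 w)" and ?m = "length w"
  have "dicycle (\<lambda>a b. (a, b) \<in> parcs G) w"
    using w by (auto simp: dicycle_def dipath_def elim: successively_mono)
  then have "undirected_cycle G ?p"
    using cycle_of_dicycle assms(1,5) by (simp add: undirected_cycle_def)
  moreover have "edge_of (?p ! i) \<in> M \<longleftrightarrow> edge_of (?p ! (Suc i mod ?m)) \<notin> M" if "i < ?m" for i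
  proof -
    let ?j = "\<lambda>i. Suc i mod ?m"
    have j: "?j i < ?m" for i using assms(5) by (intro mod_less_divisor) linarith
    have p: "?p ! k = (w ! k, w ! ?j k)" if "k < ?m" for k
      using that by (simp add: nth_rotate1)
    have a: "(w ! k, w ! ?j k) \<in> parcs G \<and> ({w ! k, w ! ?j k} \<in> M \<longleftrightarrow> w ! k \<in> X)" if "k < ?m" for k
    proof (cases "Suc k < ?m")
      case True
      then show ?thesis using w by (auto simp: dicycle_def dipath_def successively_conv_nth)
    next
      case False
      then have "k = ?m - 1" "Suc k = ?m" using that by simp_all
      moreover have "w \<noteq> []" using assms(5) by auto
      ultimately have "w ! k = last w" "w ! ?j k = hd w"
        by (simp_all add: last_conv_nth hd_conv_nth)
      then show ?thesis using w by (auto simp: dicycle_def)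
    qed
    \<comment> \<open>A matching arc is one that leaves \<open>X\<close>, so alternation is just bipartiteness.\<close>
    have "w ! i \<in> X \<longleftrightarrow> w ! ?j i \<notin> X"
      using a[OF that] assms(2) unfolding bipartition_def by blast
    then show ?thesis using p[OF that] p[OF j] a[OF that] a[OF j] by (simp add: edge_of_def)
  qed
  moreover have "fst ` set ?p = pverts G"
    using assms(4) by (metis length_rotate1 list.set_map map_fst_zip)
  ultimately show ?thesis
    by (simp add: alternating_Hamilton_cycle_def alternating_cycle_def)
qed

section \<open>Degrees and the matching as a bijection\<close>

lemma degree_conv_card: "degree G x = card {v. (x, v) \<in> parcs G}"
proof -
  have "out_arcs (with_proj G) x = Pair x ` {v. (x, v) \<in> parcs G}" by (auto simp: out_arcs_def)
  then show ?thesis by (simp add: out_degree_def card_image inj_on_def)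
qed

text \<open>Every vertex lies in exactly one matching edge, and each edge has one end on either
  side.\<close>

lemma perfect_matching_bij:
  assumes "pair_graph G" "bipartition G X Y" "perfect_matching G M"
  obtains f where "bij_betw f X Y" "\<And>x y. x \<in> X \<Longrightarrow> y \<in> Y \<Longrightarrow> {x, y} \<in> M \<longleftrightarrow> y = f x"
proof -
  interpret pair_graph G by fact
  have XY: "X \<union> Y = pverts G" "X \<inter> Y = {}"
    "\<And>u v. (u, v) \<in> parcs G \<Longrightarrow> (u \<in> X \<and> v \<in> Y) \<or> (u \<in> Y \<and> v \<in> X)"
    using assms(2) by (auto simp: bipartition_def)
  have M: "M \<subseteq> edges G" "\<And>e g. e \<in> M \<Longrightarrow> g \<in> M \<Longrightarrow> e \<inter> g \<noteq> {} \<Longrightarrow> e = g" "\<Union>M = pverts G"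
    using assms(3) by (auto simp: perfect_matching_def)
  have e: "\<exists>x\<in>X. \<exists>y\<in>Y. e = {x, y}" if eM: "e \<in> M" for e
  proof -
    obtain u v where "(u, v) \<in> parcs G" "e = {u, v}"
      using eM M(1) by (auto simp: edges_def edge_of_def)
    then show ?thesis using XY(3)[of u v] by (metis insert_commute)
  qed
  have x1: "\<exists>y\<in>Y. {x, y} \<in> M" if x: "x \<in> X" for x
  proof -
    obtain g where "g \<in> M" "x \<in> g" using x M(3) XY(1) by blast
    then show ?thesis using e[of g] x XY(2) by auto
  qed
  have y1: "\<exists>x\<in>X. {x, y} \<in> M" if y: "y \<in> Y" for y
  proof -
    obtain g where "g \<in> M" "y \<in> g" using y M(3) XY(1) by blast
    then show ?thesis using e[of g] y XY(2) by auto
  qed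
  have uniq: "x = x' \<longleftrightarrow> y = y'"
    if "{x, y} \<in> M" "{x', y'} \<in> M" "x \<in> X" "x' \<in> X" "y \<in> Y" "y' \<in> Y" for x y x' y'
    using M(2)[OF that(1,2)] that(3-) XY(2) by (auto simp: doubleton_eq_iff)
  obtain f where f: "\<And>x. x \<in> X \<Longrightarrow> f x \<in> Y \<and> {x, f x} \<in> M" using x1 by metis
  have iff: "{x, y} \<in> M \<longleftrightarrow> y = f x" if "x \<in> X" "y \<in> Y" for x y
    using f[OF that(1)] uniq that by metis
  have "bij_betw f X Y"
  proof (rule bij_betw_imageI)
    show "inj_on f X" using f uniq by (metis inj_onI)
    show "f ` X = Y" using f y1 iff by (fastforce simp: image_iff)
  qed
  then show thesis using iff that by blast
qed

section \<open>Contracting the matching\<close>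

theorem theorem2p1:
  fixes G :: "'a pair_pre_digraph" and X Y :: "'a set" and M :: "'a set set"
  assumes "pair_graph G"
    and "connected (with_proj G)"
    and "bipartition G X Y"
    and "perfect_matching G M"
    and "\<And>x y. x \<in> X \<Longrightarrow> y \<in> Y \<Longrightarrow>
           real (degree G x) + real (degree G y) \<ge> real (card (pverts G)) / 2 + 2"
  shows "\<exists>p. alternating_Hamilton_cycle G M p"
proof -
  interpret pair_graph G by fact
  have XY: "X \<union> Y = pverts G" "X \<inter> Y = {}"
    "\<And>u v. (u, v) \<in> parcs G \<Longrightarrow> (u \<in> X \<and> v \<in> Y) \<or> (u \<in> Y \<and> v \<in> X)"
    using assms(3) by (auto simp: bipartition_def)
  have fin: "finite X" "finite Y" using XY(1) pair_finite_verts by (metis finite_Un)+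
  obtain f where f: "bij_betw f X Y"
    and fM: "\<And>x y. x \<in> X \<Longrightarrow> y \<in> Y \<Longrightarrow> {x, y} \<in> M \<longleftrightarrow> y = f x"
    using perfect_matching_bij[OF assms(1,3,4)] by blast
  have fX: "f x \<in> Y" if "x \<in> X" for x using f that bij_betwE by blast
  have sym: "(u, v) \<in> parcs G \<longleftrightarrow> (v, u) \<in> parcs G" for u v
    using pair_sym_arcs by (auto simp: symmetric_def dest: symD)
  have farc: "(x, f x) \<in> parcs G" if "x \<in> X" for x
  proof -
    have "{x, f x} \<in> edges G"
      using fM[OF that fX[OF that]] assms(4) by (auto simp: perfect_matching_def)
    then show ?thesis using sym by (auto simp: edges_def edge_of_def doubleton_eq_iff)
  qed
  have cardX: "card (pverts G) = 2 * card X"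
    using XY(1,2) fin bij_betw_same_card[OF f] by (metis card_Un_disjoint mult_2)
  have "X \<noteq> {}"
  proof -
    have "pverts G \<noteq> {}" using assms(2) by (auto simp: connected_def strongly_connected_def)
    then show ?thesis using cardX pair_finite_verts by fastforce
  qed
  \<comment> \<open>The condition \<open>x \<noteq> y\<close> removes the loop that the matching
    edge at \<open>x\<close> would leave.\<close>
  define R where "R x y \<longleftrightarrow> x \<noteq> y \<and> (f x, y) \<in> parcs G" for x y
  \<comment> \<open>The \<open>Suc\<close> accounts for the matching edge; any other neighbour
    \<open>f z\<close> of \<open>x\<close> is an arc from \<open>z\<close> to
    \<open>x\<close>.\<close>
  have din: "degree G x = Suc (card {z \<in> X. R z x})" if "x \<in> X" for x
  proof -
    have "{v. (x, v) \<in> parcs G} = f ` insert x {z \<in> X. R z x}"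
    proof (intro equalityI subsetI)
      fix v assume "v \<in> {v. (x, v) \<in> parcs G}"
      moreover from this have "v \<in> Y" using XY(2) XY(3)[of x v] that by blast
      then obtain z where "z \<in> X" "v = f z" using f by (auto simp: bij_betw_def)
      ultimately show "v \<in> f ` insert x {z \<in> X. R z x}" using sym by (auto simp: R_def)
    qed (use that farc sym in \<open>auto simp: R_def\<close>)
    moreover have "inj_on f (insert x {z \<in> X. R z x})"
      by (rule inj_on_subset[of f X]) (use f that in \<open>auto simp: bij_betw_def\<close>)
    ultimately show ?thesis using fin by (simp add: degree_conv_card card_image R_def)
  qed
  have dout: "degree G (f x) = Suc (card {z \<in> X. R x z})" if "x \<in> X" for x
  proof -
    have "v \<in> X" if "(f x, v) \<in> parcs G" for v
      using XY(2) XY(3)[OF that] fX[OF \<open>x \<in> X\<close>] by blast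
    moreover have "(f x, x) \<in> parcs G" using farc[OF that] sym by blast
    ultimately have "{v. (f x, v) \<in> parcs G} = insert x {z \<in> X. R x z}"
      using that by (auto simp: R_def)
    then show ?thesis using fin by (simp add: degree_conv_card R_def)
  qed
  \<comment> \<open>The two matching edges use up the summand 2 of the degree condition, and half
    the number of vertices is \<open>card X\<close>.\<close>
  have deg: "card X \<le> card {z \<in> X. R x z} + card {z \<in> X. R z y}" if "x \<in> X" "y \<in> X" for x y
    using assms(5)[OF that(2) fX[OF that(1)]] din[OF that(2)] dout[OF that(1)] cardX by simp
  \<comment> \<open>Without loops both degrees of a vertex are at most \<open>card X - 1\<close>, so
    \<open>deg\<close> at a single vertex excludes \<open>card X = 1\<close>.\<close>
  have card2: "2 \<le> card X"
  proof -
    obtain x where x: "x \<in> X" using \<open>X \<noteq> {}\<close> by blast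
    have "{z \<in> X. R x z} \<subseteq> X - {x}" "{z \<in> X. R z x} \<subseteq> X - {x}" by (auto simp: R_def)
    then have "card {z \<in> X. R x z} \<le> card X - 1" "card {z \<in> X. R z x} \<le> card X - 1"
      using x fin by (metis card_Diff_singleton card_mono finite_Diff)+
    moreover have "0 < card X" using x fin card_gt_0_iff by blast
    ultimately show ?thesis using deg[OF x x] by linarith
  qed
  obtain xs where xs: "dicycle R xs" "set xs = X"
    using Hamilton_dicycle[of X R] fin card2 deg by (auto simp: R_def)
  define w where "w = concat (map (\<lambda>x. [x, f x]) xs)"
  let ?E = "\<lambda>a b. (a, b) \<in> parcs G \<and> ({a, b} \<in> M \<longleftrightarrow> a \<in> X)"
  have img: "f ` X = Y" "inj_on f X" using f by (auto simp: bij_betw_def)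
  have "?E (f x) y" if "x \<in> X" "y \<in> X" "R x y" for x y
  proof -
    \<comment> \<open>The matching edge at \<open>y\<close> goes to \<open>f y\<close>, so the edge
      from \<open>f x\<close> to \<open>y\<close> is outside \<open>M\<close>.\<close>
    have "f x \<noteq> f y" using that img(2) by (auto simp: R_def inj_on_def)
    then have "{f x, y} \<notin> M" using fM[OF that(2) fX[OF that(1)]] by (simp add: insert_commute)
    then show ?thesis using that fX XY(2) by (auto simp: R_def)
  qed
  moreover have "?E x (f x)" if "x \<in> X" for x
    using that farc fM[OF that fX[OF that]] by simp
  moreover have "f ` X \<inter> X = {}" using img(1) XY(2) by blast
  ultimately have dw: "dicycle ?E w"
    unfolding w_def using dicycle_expand[OF xs(1), of f ?E] img(2) xs(2) by blast
  have setw: "set w = pverts G" using xs(2) img(1) XY(1) by (auto simp: w_def)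
  have "distinct w" using dw by (simp add: dicycle_def dipath_def)
  then have "3 \<le> length w" using setw cardX card2 distinct_card[of w] by simp
  with dw setw show ?thesis
    using alternating_Hamilton_cycle_of_dicycle[OF pair_wf_digraph_axioms assms(3)] by blast
qed

end
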